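(* Let $F: Q \to \mathbf{E}^*$ be a continuous, bounded, and $\delta$-monotone operator. Let $\{\gamma_k\}_{k\ge 1}$ be a positive non-increasing sequence of step sizes, let $m \ge -1$ be a fixed real number, let $N\ge 1$, let $x^1\in Q$, and let $x^1,\dots,x^N$ be generated by the mirror descent iteration $$x^{k+1} = \arg\min_{x \in Q} \left\{ \langle F(x^k), x \rangle + \frac{1}{\gamma_k} V_{\psi}(x,x^k) \right\},\qquad k=1,\dots,N.$$ Set $$\widehat{x} = \frac{1}{\sum_{k= 1}^{N} \gamma_k^{-m}} \sum_{k = 1}^{N} \gamma_k^{-m} x^k .$$ Then $$\operatorname{Gap} (\widehat{x}) \leq \frac{1}{\sum_{k= 1}^{N} \gamma_k^{-m}} \left( \frac{R}{\gamma_N^{m+1}} + \frac{1}{2 \sigma} \sum_{k= 1}^{N} \frac{ \|F(x^k)\|_*^2}{\gamma_k^{m -1}} \right) + \delta .$$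
   Context: $(\mathbf{E},\|\cdot\|)$ is a finite-dimensional normed real vector space (arbitrary norm), $\mathbf{E}^*$ its dual with norm $\|y\|_*=\max\{\langle y,x\rangle : \|x\|\le 1\}$, where $\langle y,x\rangle$ is the value of $y\in\mathbf{E}^*$ at $x\in\mathbf{E}$. $Q\subset\mathbf{E}$ is a (nonempty) convex compact set. The prox-function $\psi:Q\to\mathbb{R}$ is proper, closed, differentiable and $\sigma$-strongly convex ($\sigma>0$) with respect to $\|\cdot\|$; its Bregman divergence is $V_\psi(x,y)=\psi(x)-\psi(y)-\langle\nabla\psi(y),x-y\rangle$ for $x,y\in Q$. It is assumed that $R>0$ is a constant with $V_\psi(x,y)\le R<\infty$ for all $x,y\in Q$. The operator $F:Q\to\mathbf{E}^*$ is $\delta$-monotone if $\langle F(y)-F(x),y-x\rangle\ge-\delta$ for all $x,y\in Q$, where $\delta\ge 0$ (the case $\delta=0$ is ordinary monotonicity). It is bounded if there is $L_F>0$ with $\|F(x)\|_*\le L_F$ for all $x\in Q$. The underlying problem is to find $x^*\in Q$ with $\langle F(x),x^*-x\rangle\le 0$ for all $x\in Q$. The restricted gap function is $\operatorname{Gap}(\widehat{x})=\max_{u\in Q}\langle F(u),\widehat{x}-u\rangle$. *)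

theory Defs
  imports "HOL-Analysis.Analysis"
begin

(* The dual space E* is rendered as 'a \<Rightarrow>\<^sub>L real: on a finite-dimensional space every
   linear functional is bounded.  Its norm is the operator norm, which is the dual norm: *)
lemma norm_dual_eq_SUP:
  fixes y :: "'a::real_normed_vector \<Rightarrow>\<^sub>L real"
  shows "norm y = (SUP x\<in>{x. norm x \<le> 1}. blinfun_apply y x)"
proof (rule antisym)
  have bdd: "bdd_above (blinfun_apply y ` {x. norm x \<le> 1})"
  proof (rule bdd_aboveI2)
    fix x :: 'a assume "x \<in> {x. norm x \<le> 1}"
    then show "blinfun_apply y x \<le> norm y"
      using norm_blinfun[of y x] mult_left_mono[of "norm x" 1 "norm y"] by auto
  qed
  show "(SUP x\<in>{x. norm x \<le> 1}. blinfun_apply y x) \<le> norm y"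
  proof (rule cSUP_least)
    show "{x::'a. norm x \<le> 1} \<noteq> {}" by (auto intro: exI[of _ 0])
    fix x :: 'a assume "x \<in> {x. norm x \<le> 1}"
    then show "blinfun_apply y x \<le> norm y"
      using norm_blinfun[of y x] mult_left_mono[of "norm x" 1 "norm y"] by auto
  qed
  let ?S = "SUP x\<in>{x. norm x \<le> 1}. blinfun_apply y x"
  have le: "blinfun_apply y x \<le> ?S" if "norm x \<le> 1" for x
    using that by (intro cSUP_upper bdd) auto
  show "norm y \<le> ?S"
  proof (rule norm_blinfun_bound)
    show "0 \<le> ?S" using le[of 0] by simp
    fix x
    show "norm (blinfun_apply y x) \<le> ?S * norm x"
    proof (cases "x = 0")
      case False
      have "blinfun_apply y (x /\<^sub>R norm x) \<le> ?S" "blinfun_apply y (- x /\<^sub>R norm x) \<le> ?S"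
        using False by (auto intro!: le)
      then show ?thesis
        using False by (simp add: blinfun.scaleR_right blinfun.minus_right field_simps abs_le_iff)
    qed simp
  qed
qed

definition strongly_convex_on ::
    "real \<Rightarrow> 'a::real_normed_vector set \<Rightarrow> ('a \<Rightarrow> real) \<Rightarrow> bool" where
  "strongly_convex_on \<sigma> Q \<psi> \<longleftrightarrow> convex Q \<and>
     (\<forall>x\<in>Q. \<forall>y\<in>Q. \<forall>t\<in>{0..1}.
        \<psi> (t *\<^sub>R x + (1 - t) *\<^sub>R y)
          \<le> t * \<psi> x + (1 - t) * \<psi> y - \<sigma> / 2 * t * (1 - t) * (norm (x - y))\<^sup>2)"

(* The domain of \<psi> is Q, so properness amounts to Q being nonempty, closedness is that of the
   epigraph over Q, and differentiability is relative to Q (which may have boundary points or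
   empty interior). *)
definition prox_function ::
    "real \<Rightarrow> 'a::real_normed_vector set \<Rightarrow> ('a \<Rightarrow> real) \<Rightarrow> bool" where
  "prox_function \<sigma> Q \<psi> \<longleftrightarrow>
     Q \<noteq> {} \<and> closed (epigraph Q \<psi>) \<and> \<psi> differentiable_on Q \<and> strongly_convex_on \<sigma> Q \<psi>"

definition bregman ::
    "'a::real_normed_vector set \<Rightarrow> ('a \<Rightarrow> real) \<Rightarrow> 'a \<Rightarrow> 'a \<Rightarrow> real" where
  "bregman Q \<psi> x y = \<psi> x - \<psi> y - frechet_derivative \<psi> (at y within Q) (x - y)"

(* The derivative within Q need not be unique, but its value in the directions x - y with
   x, y in Q is; in particular any ambient gradient gives the same divergence. *)
lemma bregman_eq:
  assumes "convex Q" "x \<in> Q" "y \<in> Q" and D: "(\<psi> has_derivative D) (at y within Q)"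
  shows "bregman Q \<psi> x y = \<psi> x - \<psi> y - D (x - y)"
proof -
  let ?l = "\<lambda>t::real. y + t *\<^sub>R (x - y)"
  have l: "?l ` {0..1} \<subseteq> Q"
  proof
    fix z assume "z \<in> ?l ` {0..1}"
    then obtain t where "t \<in> {0..1}" "z = (1 - t) *\<^sub>R y + t *\<^sub>R x"
      by (auto simp: algebra_simps)
    then show "z \<in> Q" using assms(1-3) by (auto intro!: convexD)
  qed
  have dir: "((\<psi> \<circ> ?l) has_vector_derivative E (x - y)) (at 0 within {0..1})"
    if E: "(\<psi> has_derivative E) (at y within Q)" for E
  proof -
    have "(?l has_derivative (\<lambda>t. t *\<^sub>R (x - y))) (at 0 within {0..1})"
      by (auto intro!: derivative_eq_intros)
    moreover have "(\<psi> has_derivative E) (at (?l 0) within ?l ` {0..1})"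
      using has_derivative_subset[OF E l] by simp
    ultimately have "((\<psi> \<circ> ?l) has_derivative (E \<circ> (\<lambda>t. t *\<^sub>R (x - y)))) (at 0 within {0..1})"
      by (rule diff_chain_within)
    moreover have "E \<circ> (\<lambda>t. t *\<^sub>R (x - y)) = (\<lambda>t. t *\<^sub>R E (x - y))"
      using linear_cmul[OF has_derivative_linear[OF E]] by auto
    ultimately show ?thesis by (simp add: has_vector_derivative_def)
  qed
  have "(\<psi> has_derivative frechet_derivative \<psi> (at y within Q)) (at y within Q)"
    using D frechet_derivative_works differentiable_def by blast
  from dir[OF this] dir[OF D] have "frechet_derivative \<psi> (at y within Q) (x - y) = D (x - y)"
    by (intro vector_derivative_unique_within_closed_interval[of 0 1 0]) auto
  then show ?thesis by (simp add: bregman_def)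
qed

definition delta_monotone_on ::
    "real \<Rightarrow> 'a::real_normed_vector set \<Rightarrow> ('a \<Rightarrow> 'a \<Rightarrow>\<^sub>L real) \<Rightarrow> bool" where
  "delta_monotone_on \<delta> Q F \<longleftrightarrow> (\<forall>x\<in>Q. \<forall>y\<in>Q. blinfun_apply (F y - F x) (y - x) \<ge> - \<delta>)"

definition bounded_operator_on ::
    "'a::real_normed_vector set \<Rightarrow> ('a \<Rightarrow> 'a \<Rightarrow>\<^sub>L real) \<Rightarrow> bool" where
  "bounded_operator_on Q F \<longleftrightarrow> (\<exists>L>0. \<forall>x\<in>Q. norm (F x) \<le> L)"

definition restricted_gap ::
    "'a::real_normed_vector set \<Rightarrow> ('a \<Rightarrow> 'a \<Rightarrow>\<^sub>L real) \<Rightarrow> 'a \<Rightarrow> real" where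
  "restricted_gap Q F z = (SUP u\<in>Q. blinfun_apply (F u) (z - u))"

(* For continuous F the supremum is a maximum. *)
lemma restricted_gap_attained:
  assumes "compact Q" "Q \<noteq> {}" "continuous_on Q F"
  shows "\<exists>u\<in>Q. restricted_gap Q F z = blinfun_apply (F u) (z - u) \<and>
           (\<forall>v\<in>Q. blinfun_apply (F v) (z - v) \<le> blinfun_apply (F u) (z - u))"
proof -
  have "continuous_on Q (\<lambda>u. blinfun_apply (F u) (z - u))"
    using assms(3) by (intro continuous_intros)
  from continuous_attains_sup[OF assms(1,2) this] obtain u where
    u: "u \<in> Q" "\<And>v. v \<in> Q \<Longrightarrow> blinfun_apply (F v) (z - v) \<le> blinfun_apply (F u) (z - u)"
    by blast
  then have "restricted_gap Q F z = blinfun_apply (F u) (z - u)"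
    unfolding restricted_gap_def by (intro cSup_eq_maximum) auto
  with u show ?thesis by blast
qed

end

theory Submission
  imports Defs
begin

text \<open>
  First-order optimality of \<open>x\<^sup>k\<^sup>+\<^sup>1\<close> and the three-point identity for the Bregman divergence turn one
  step into \<open>\<langle>F(x\<^sup>k), x\<^sup>k - u\<rangle> \<le> (V(u,x\<^sup>k) - V(u,x\<^sup>k\<^sup>+\<^sup>1)) / \<gamma>\<^sub>k + \<gamma>\<^sub>k \<parallel>F(x\<^sup>k)\<parallel>\<^sup>2 / (2\<sigma>)\<close>, where the term
  \<open>V(x\<^sup>k\<^sup>+\<^sup>1,x\<^sup>k) \<ge> \<sigma>/2 \<parallel>x\<^sup>k\<^sup>+\<^sup>1 - x\<^sup>k\<parallel>\<^sup>2\<close> absorbs the displacement. Multiplying by \<open>\<gamma>\<^sub>k\<^sup>-\<^sup>m\<close> and summing, the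
  divergences telescope up to the increments of the nondecreasing weights \<open>\<gamma>\<^sub>k\<^sup>-\<^sup>(\<^sup>m\<^sup>+\<^sup>1\<^sup>)\<close>, and these
  cost at most \<open>R \<gamma>\<^sub>N\<^sup>-\<^sup>(\<^sup>m\<^sup>+\<^sup>1\<^sup>)\<close>. Finally \<open>\<delta>\<close>-monotonicity replaces \<open>F(x\<^sup>k)\<close> by \<open>F(u)\<close>.
\<close>

lemma segment_subset:
  assumes "convex Q" "x \<in> Q" "y \<in> Q" "t \<in> {0..1::real}"
  shows "x + t *\<^sub>R (y - x) \<in> Q"
  using convexD[OF assms(1-3), of "1 - t" t] assms(4) by (simp add: algebra_simps)

text \<open>By convexity the segment from \<open>x\<close> to \<open>y\<close> stays in
  \<open>Q\<close>, so the chain rule applies to the derivative within \<open>Q\<close>. The limit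
  is one-sided because \<open>x\<close> may lie on the boundary.\<close>

lemma directional_derivative_tendsto:
  fixes \<psi> :: "'a::real_normed_vector \<Rightarrow> real"
  assumes "convex Q" "x \<in> Q" "y \<in> Q" and D: "(\<psi> has_derivative D) (at x within Q)"
  shows "((\<lambda>t. (\<psi> (x + t *\<^sub>R (y - x)) - \<psi> x) / t) \<longlongrightarrow> D (y - x)) (at_right 0)"
proof -
  let ?l = "\<lambda>t::real. x + t *\<^sub>R (y - x)"
  have l: "?l ` {0..1} \<subseteq> Q"
    using segment_subset[OF assms(1-3)] by blast
  have "(?l has_derivative (\<lambda>t. t *\<^sub>R (y - x))) (at 0 within {0..1})"
    by (auto intro!: derivative_eq_intros)
  moreover have "(\<psi> has_derivative D) (at (?l 0) within ?l ` {0..1})"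
    using has_derivative_subset[OF D l] by simp
  ultimately have "((\<psi> \<circ> ?l) has_derivative (D \<circ> (\<lambda>t. t *\<^sub>R (y - x)))) (at 0 within {0..1})"
    by (rule diff_chain_within)
  moreover have "D \<circ> (\<lambda>t. t *\<^sub>R (y - x)) = (*) (D (y - x))"
    using linear_cmul[OF has_derivative_linear[OF D]] by auto
  ultimately have "((\<psi> \<circ> ?l) has_field_derivative D (y - x)) (at 0 within {0..1})"
    by (simp add: has_field_derivative_def)
  then show ?thesis
    by (simp add: has_field_derivative_iff at_within_Icc_at_right)
qed

lemma eventually_at_right_0_unit: "eventually (\<lambda>t::real. 0 < t \<and> t < 1) (at_right 0)"
  using eventually_at_right_real[of 0 1] by simp

lemma prox_function_has_derivative:
  assumes "prox_function \<sigma> Q \<psi>" "x \<in> Q"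
  shows "(\<psi> has_derivative frechet_derivative \<psi> (at x within Q)) (at x within Q)"
  using assms unfolding prox_function_def differentiable_on_def
  by (meson frechet_derivative_works)

text \<open>Strong convexity on the segment, divided by \<open>t\<close>, bounds the difference
  quotient from above; letting \<open>t\<close> tend to 0 from the right turns the factor
  \<open>1 - t\<close> into 1.\<close>

lemma bregman_ge_norm_sq:
  assumes prox: "prox_function \<sigma> Q \<psi>" and x: "x \<in> Q" and y: "y \<in> Q"
  shows "\<sigma> / 2 * (norm (y - x))\<^sup>2 \<le> bregman Q \<psi> y x"
proof -
  let ?D = "frechet_derivative \<psi> (at x within Q)"
  let ?d = "\<sigma> / 2 * (norm (y - x))\<^sup>2"
  have sc: "strongly_convex_on \<sigma> Q \<psi>"
    using prox by (simp add: prox_function_def)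
  then have conv: "convex Q"
    by (simp add: strongly_convex_on_def)
  \<comment> \<open>Writing \<open>1 - 0\<close> keeps the limit in the shape that
    \<open>tendsto_intros\<close> produces.\<close>
  have "((\<lambda>t. \<psi> y - \<psi> x - (1 - t) * ?d) \<longlongrightarrow> \<psi> y - \<psi> x - (1 - 0) * ?d) (at_right 0)"
    by (intro tendsto_intros)
  moreover have "((\<lambda>t. (\<psi> (x + t *\<^sub>R (y - x)) - \<psi> x) / t) \<longlongrightarrow> ?D (y - x)) (at_right 0)"
    by (rule directional_derivative_tendsto[OF conv x y prox_function_has_derivative[OF prox x]])
  moreover have "eventually (\<lambda>t. (\<psi> (x + t *\<^sub>R (y - x)) - \<psi> x) / t \<le> \<psi> y - \<psi> x - (1 - t) * ?d)
      (at_right 0)"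
    using eventually_at_right_0_unit
  proof eventually_elim
    case (elim t)
    have "\<psi> (t *\<^sub>R y + (1 - t) *\<^sub>R x)
        \<le> t * \<psi> y + (1 - t) * \<psi> x - \<sigma> / 2 * t * (1 - t) * (norm (y - x))\<^sup>2"
      using sc x y elim unfolding strongly_convex_on_def by auto
    moreover have "t *\<^sub>R y + (1 - t) *\<^sub>R x = x + t *\<^sub>R (y - x)"
      by (simp add: algebra_simps)
    ultimately have "\<psi> (x + t *\<^sub>R (y - x)) - \<psi> x \<le> (\<psi> y - \<psi> x - (1 - t) * ?d) * t"
      by (simp add: algebra_simps)
    then show ?case
      using elim by (simp add: pos_divide_le_eq)
  qed
  ultimately have "?D (y - x) \<le> \<psi> y - \<psi> x - (1 - 0) * ?d"
    by (rule tendsto_le[OF trivial_limit_at_right_real])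
  then show ?thesis
    by (simp add: bregman_def)
qed

text \<open>The values of \<psi> cancel, and linearity of the derivative at \<open>x\<close> merges
  its directions \<open>u - x\<close> and \<open>y - x\<close> into \<open>u - y\<close>.\<close>

lemma bregman_three_point:
  assumes "prox_function \<sigma> Q \<psi>" "x \<in> Q"
  shows "bregman Q \<psi> u x - bregman Q \<psi> u y - bregman Q \<psi> y x
    = frechet_derivative \<psi> (at y within Q) (u - y) - frechet_derivative \<psi> (at x within Q) (u - y)"
proof -
  interpret D: linear "frechet_derivative \<psi> (at x within Q)"
    by (rule has_derivative_linear[OF prox_function_has_derivative[OF assms]])
  show ?thesis
    by (simp add: bregman_def D.diff)
qed

text \<open>The minimizer \<open>y\<close> is compared with nearby points of the segment towards
  \<open>u\<close>. Dividing by \<open>t\<close> and letting \<open>t\<close> tend to 0 gives the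
  variational inequality, which the three-point identity rewrites in divergences.\<close>

lemma prox_step_optimality:
  fixes G :: "'a::real_normed_vector \<Rightarrow>\<^sub>L real"
  assumes prox: "prox_function \<sigma> Q \<psi>" and "c > 0" and x: "x \<in> Q" and u: "u \<in> Q"
    and arg: "is_arg_min (\<lambda>u. blinfun_apply G u + 1 / c * bregman Q \<psi> u x) (\<lambda>u. u \<in> Q) y"
  shows "c * blinfun_apply G (y - u)
    \<le> bregman Q \<psi> u x - bregman Q \<psi> u y - bregman Q \<psi> y x"
proof -
  let ?Dx = "frechet_derivative \<psi> (at x within Q)"
  let ?Dy = "frechet_derivative \<psi> (at y within Q)"
  interpret Dx: linear ?Dx
    by (rule has_derivative_linear[OF prox_function_has_derivative[OF prox x]])
  have conv: "convex Q"
    using prox by (simp add: prox_function_def strongly_convex_on_def)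
  have y: "y \<in> Q"
    and min: "\<And>z. z \<in> Q \<Longrightarrow> blinfun_apply G y + 1 / c * bregman Q \<psi> y x
      \<le> blinfun_apply G z + 1 / c * bregman Q \<psi> z x"
    using arg by (auto simp: is_arg_min_linorder)
  have "((\<lambda>t. (\<psi> (y + t *\<^sub>R (u - y)) - \<psi> y) / t) \<longlongrightarrow> ?Dy (u - y)) (at_right 0)"
    by (rule directional_derivative_tendsto[OF conv y u prox_function_has_derivative[OF prox y]])
  moreover have "eventually
      (\<lambda>t. ?Dx (u - y) - c * blinfun_apply G (u - y) \<le> (\<psi> (y + t *\<^sub>R (u - y)) - \<psi> y) / t)
      (at_right 0)"
    using eventually_at_right_0_unit
  proof eventually_elim
    case (elim t)
    let ?z = "y + t *\<^sub>R (u - y)"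
    have "?z \<in> Q"
      using elim by (intro segment_subset[OF conv y u]) auto
    then have "c * (blinfun_apply G y + 1 / c * bregman Q \<psi> y x)
        \<le> c * (blinfun_apply G ?z + 1 / c * bregman Q \<psi> ?z x)"
      using \<open>c > 0\<close> by (intro mult_left_mono min) auto
    then have "bregman Q \<psi> y x - bregman Q \<psi> ?z x \<le> c * (t * blinfun_apply G (u - y))"
      using \<open>c > 0\<close> by (simp add: blinfun.add_right blinfun.scaleR_right distrib_left)
    moreover have "bregman Q \<psi> y x - bregman Q \<psi> ?z x = t * ?Dx (u - y) - (\<psi> ?z - \<psi> y)"
      by (simp add: bregman_def Dx.diff Dx.add Dx.scale)
    ultimately have "(?Dx (u - y) - c * blinfun_apply G (u - y)) * t \<le> \<psi> ?z - \<psi> y"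
      by (simp add: algebra_simps)
    then show ?case
      using elim by (simp add: pos_le_divide_eq)
  qed
  ultimately have "?Dx (u - y) - c * blinfun_apply G (u - y) \<le> ?Dy (u - y)"
    by (intro tendsto_lowerbound) auto
  then show ?thesis
    unfolding bregman_three_point[OF prox x] by (simp add: blinfun.diff_right right_diff_distrib)
qed

text \<open>Split \<open>x - u\<close> into \<open>x - y\<close> and \<open>y - u\<close>.
  Optimality handles the second part; the dual norm and Young's inequality handle the first.\<close>

lemma mirror_descent_step:
  fixes G :: "'a::real_normed_vector \<Rightarrow>\<^sub>L real"
  assumes prox: "prox_function \<sigma> Q \<psi>" and "\<sigma> > 0" "c > 0" and x: "x \<in> Q" and u: "u \<in> Q"
    and arg: "is_arg_min (\<lambda>u. blinfun_apply G u + 1 / c * bregman Q \<psi> u x) (\<lambda>u. u \<in> Q) y"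
  shows "blinfun_apply G (x - u)
    \<le> (bregman Q \<psi> u x - bregman Q \<psi> u y) / c + c * (norm G)\<^sup>2 / (2 * \<sigma>)"
proof -
  have y: "y \<in> Q"
    using arg by (simp add: is_arg_min_def)
  let ?g = "c * norm G" and ?n = "norm (y - x)"
  have "c * blinfun_apply G (x - y) \<le> ?g * ?n"
    using norm_blinfun[of G "x - y"] \<open>c > 0\<close> by (simp add: norm_minus_commute)
  also have "\<dots> \<le> ?g\<^sup>2 / (2 * \<sigma>) + \<sigma> / 2 * ?n\<^sup>2"
  proof -
    \<comment> \<open>Young's inequality, weighted by \<sigma> so that its quadratic term is exactly
      the lower bound of \<open>bregman Q \<psi> y x\<close>.\<close>
    have "0 \<le> (?g - \<sigma> * ?n)\<^sup>2 / (2 * \<sigma>)"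
      using \<open>\<sigma> > 0\<close> by simp
    also have "\<dots> = ?g\<^sup>2 / (2 * \<sigma>) + \<sigma> / 2 * ?n\<^sup>2 - ?g * ?n"
      using \<open>\<sigma> > 0\<close> by (simp add: power2_eq_square field_simps)
    finally show ?thesis
      by simp
  qed
  also have "\<dots> \<le> ?g\<^sup>2 / (2 * \<sigma>) + bregman Q \<psi> y x"
    using bregman_ge_norm_sq[OF prox x y] by simp
  finally have "c * blinfun_apply G (x - u)
      \<le> bregman Q \<psi> u x - bregman Q \<psi> u y + ?g\<^sup>2 / (2 * \<sigma>)"
    using prox_step_optimality[OF prox \<open>c > 0\<close> x u arg]
    by (simp add: blinfun.diff_right right_diff_distrib)
  then have "blinfun_apply G (x - u)
      \<le> (bregman Q \<psi> u x - bregman Q \<psi> u y + ?g\<^sup>2 / (2 * \<sigma>)) / c"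
    using \<open>c > 0\<close> by (simp add: pos_le_divide_eq mult.commute)
  also have "\<dots> = (bregman Q \<psi> u x - bregman Q \<psi> u y) / c + c * (norm G)\<^sup>2 / (2 * \<sigma>)"
    using \<open>c > 0\<close> by (simp add: add_divide_distrib power2_eq_square)
  finally show ?thesis .
qed

text \<open>Summation by parts. Keeping \<open>- w n * V (Suc n)\<close> in the bound lets the
  induction step face only \<open>(w (Suc n) - w n) * V (Suc n)\<close>, whose coefficient is
  nonnegative.\<close>

lemma weighted_telescope_le:
  fixes w V :: "nat \<Rightarrow> real"
  assumes "1 \<le> n" "0 \<le> w 1"
    and "\<And>k. 1 \<le> k \<Longrightarrow> k < n \<Longrightarrow> w k \<le> w (Suc k)"
    and "\<And>k. 1 \<le> k \<Longrightarrow> k \<le> n \<Longrightarrow> V k \<le> R"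
  shows "(\<Sum>k=1..n. w k * (V k - V (Suc k))) \<le> w n * (R - V (Suc n))"
  using assms
proof (induction n rule: nat_induct_at_least)
  case base
  then show ?case
    by (simp add: mult_left_mono)
next
  case (Suc n)
  have "(w (Suc n) - w n) * V (Suc n) \<le> (w (Suc n) - w n) * R"
    using Suc by (intro mult_left_mono) auto
  moreover have "(\<Sum>k=1..n. w k * (V k - V (Suc k))) \<le> w n * (R - V (Suc n))"
    using Suc by simp
  ultimately show ?case
    by (simp add: algebra_simps)
qed

theorem theorem3p5:
  fixes Q B :: "'a::real_normed_vector set"
    and \<psi> :: "'a \<Rightarrow> real"
    and F :: "'a \<Rightarrow> 'a \<Rightarrow>\<^sub>L real"
    and \<gamma> :: "nat \<Rightarrow> real"
    and x :: "nat \<Rightarrow> 'a"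
    and xhat :: 'a
    and \<sigma> R \<delta> m :: real
    and N :: nat
  assumes "finite_dimensional_vector_space ((*\<^sub>R) :: real \<Rightarrow> 'a \<Rightarrow> 'a) B"
    and "Q \<noteq> {}" and "convex Q" and "compact Q"
    and "\<sigma> > 0" and "prox_function \<sigma> Q \<psi>"
    and "R > 0" and "\<forall>u\<in>Q. \<forall>v\<in>Q. bregman Q \<psi> u v \<le> R"
    and "continuous_on Q F" and "bounded_operator_on Q F"
    and "\<delta> \<ge> 0" and "delta_monotone_on \<delta> Q F"
    and "\<forall>k\<ge>1. \<gamma> k > 0" and "antimono_on {1..} \<gamma>"
    and "m \<ge> -1" and "N \<ge> 1"
    and "x 1 \<in> Q"
    and "\<forall>k\<in>{1..N}. is_arg_min
           (\<lambda>u. blinfun_apply (F (x k)) u + 1 / \<gamma> k * bregman Q \<psi> u (x k))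
           (\<lambda>u. u \<in> Q) (x (k + 1))"
    and "xhat = (1 / (\<Sum>k=1..N. \<gamma> k powr (- m))) *\<^sub>R (\<Sum>k=1..N. \<gamma> k powr (- m) *\<^sub>R x k)"
  shows "restricted_gap Q F xhat
           \<le> 1 / (\<Sum>k=1..N. \<gamma> k powr (- m)) *
               (R / \<gamma> N powr (m + 1)
                + 1 / (2 * \<sigma>) * (\<Sum>k=1..N. (norm (F (x k)))\<^sup>2 / \<gamma> k powr (m - 1)))
             + \<delta>"
proof -
  define S where "S = (\<Sum>k=1..N. \<gamma> k powr (- m))"
  define T where "T = R / \<gamma> N powr (m + 1)
    + 1 / (2 * \<sigma>) * (\<Sum>k=1..N. (norm (F (x k)))\<^sup>2 / \<gamma> k powr (m - 1))"
  note prox = \<open>prox_function \<sigma> Q \<psi>\<close>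
  have \<gamma>: "\<gamma> k > 0" if "1 \<le> k" for k
    using that assms(13) by blast
  have step: "is_arg_min (\<lambda>u. blinfun_apply (F (x k)) u + 1 / \<gamma> k * bregman Q \<psi> u (x k))
      (\<lambda>u. u \<in> Q) (x (Suc k))" if "k \<in> {1..N}" for k
    using that assms(18) by simp
  \<comment> \<open>The range includes \<open>Suc N\<close>, since the last step involves the
    divergence from \<open>x (Suc N)\<close>.\<close>
  have xQ: "x k \<in> Q" if "1 \<le> k" "k \<le> Suc N" for k
  proof (cases "k = 1")
    case False
    then have "k - 1 \<in> {1..N}" "Suc (k - 1) = k"
      using that by auto
    then show ?thesis
      using step[of "k - 1"] by (simp add: is_arg_min_def)
  qed (use \<open>x 1 \<in> Q\<close> in simp)
  have S: "S > 0"
    unfolding S_def using \<open>N \<ge> 1\<close> by (intro sum_pos) (auto simp: less_imp_neq[OF \<gamma>, symmetric])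
  have "blinfun_apply (F u) (xhat - u) \<le> 1 / S * T + \<delta>" if u: "u \<in> Q" for u
  proof -
    \<comment> \<open>Multiplying the step inequality by \<open>\<gamma> k powr (- m)\<close> turns
      its factor \<open>1 / \<gamma> k\<close> into this weight.\<close>
    define w where "w k = 1 / \<gamma> k powr (m + 1)" for k
    define V where "V k = bregman Q \<psi> u (x k)" for k
    \<comment> \<open>The normalized weights sum to 1, so \<open>u\<close> can be moved inside the
      average.\<close>
    have "xhat - u = (1 / S) *\<^sub>R (\<Sum>k=1..N. \<gamma> k powr (- m) *\<^sub>R (x k - u))"
      using S unfolding assms(19)
      by (simp del: One_nat_def add: S_def[symmetric] scaleR_diff_right sum_subtractf flip: scaleR_left.sum)
    then have "blinfun_apply (F u) (xhat - u)
        = 1 / S * (\<Sum>k=1..N. \<gamma> k powr (- m) * blinfun_apply (F u) (x k - u))"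
      by (simp add: blinfun.scaleR_right blinfun.sum_right)
    also have "\<dots> \<le> 1 / S * (\<Sum>k=1..N. w k * (V k - V (Suc k))
        + 1 / (2 * \<sigma>) * ((norm (F (x k)))\<^sup>2 / \<gamma> k powr (m - 1)) + \<gamma> k powr (- m) * \<delta>)"
    proof (intro mult_left_mono sum_mono)
      fix k assume k: "k \<in> {1..N}"
      have xk: "x k \<in> Q" and \<gamma>k: "\<gamma> k > 0"
        using k xQ \<gamma> by auto
      have "- \<delta> \<le> blinfun_apply (F (x k) - F u) (x k - u)"
        using \<open>delta_monotone_on \<delta> Q F\<close> u xk by (simp add: delta_monotone_on_def)
      then have "blinfun_apply (F u) (x k - u)
          \<le> (V k - V (Suc k)) / \<gamma> k + \<gamma> k * (norm (F (x k)))\<^sup>2 / (2 * \<sigma>) + \<delta>"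
        using mirror_descent_step[OF prox \<open>\<sigma> > 0\<close> \<gamma>k xk u step[OF k]]
        by (simp add: V_def blinfun.diff_left)
      then have "\<gamma> k powr (- m) * blinfun_apply (F u) (x k - u) \<le> \<gamma> k powr (- m)
          * ((V k - V (Suc k)) / \<gamma> k + \<gamma> k * (norm (F (x k)))\<^sup>2 / (2 * \<sigma>) + \<delta>)"
        by (rule mult_left_mono) simp
      also have "\<dots> = w k * (V k - V (Suc k))
          + 1 / (2 * \<sigma>) * ((norm (F (x k)))\<^sup>2 / \<gamma> k powr (m - 1)) + \<gamma> k powr (- m) * \<delta>"
        using \<gamma>k \<open>\<sigma> > 0\<close> by (simp add: w_def powr_add powr_diff powr_minus field_simps)
      finally show "\<gamma> k powr (- m) * blinfun_apply (F u) (x k - u) \<le> \<dots>" .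
    qed (use S in simp)
    \<comment> \<open>The \<delta> terms add up to \<open>S * \<delta>\<close>, and the
      normalization leaves a single \<delta>.\<close>
    also have "\<dots> = 1 / S * ((\<Sum>k=1..N. w k * (V k - V (Suc k)))
        + 1 / (2 * \<sigma>) * (\<Sum>k=1..N. (norm (F (x k)))\<^sup>2 / \<gamma> k powr (m - 1))) + \<delta>"
      unfolding sum.distrib sum_distrib_left[symmetric] sum_distrib_right[symmetric] S_def[symmetric]
      using S by (simp add: distrib_left)
    also have "\<dots> \<le> 1 / S * T + \<delta>"
    proof -
      have "(\<Sum>k=1..N. w k * (V k - V (Suc k))) \<le> w N * (R - V (Suc N))"
      proof (rule weighted_telescope_le[OF \<open>N \<ge> 1\<close>])
        \<comment> \<open>Here \<open>m \<ge> -1\<close> enters: the exponent \<open>m + 1\<close>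
          is nonnegative, so decreasing step sizes give nondecreasing weights.\<close>
        show "w k \<le> w (Suc k)" if "1 \<le> k" "k < N" for k
        proof -
          have "\<gamma> (Suc k) \<le> \<gamma> k"
            using \<open>antimono_on {1..} \<gamma>\<close> that by (auto simp: monotone_on_def)
          then show ?thesis
            unfolding w_def using \<gamma>[of k] \<gamma>[of "Suc k"] that \<open>m \<ge> -1\<close>
            by (intro divide_left_mono powr_mono2) auto
        qed
        show "V k \<le> R" if "1 \<le> k" "k \<le> N" for k
          using that xQ u assms(8) by (simp add: V_def)
      qed (simp add: w_def)
      \<comment> \<open>The leftover divergence is nonnegative by strong convexity and is
        dropped.\<close>
      also have "\<dots> \<le> w N * R"
      proof (rule mult_left_mono)
        have "0 \<le> \<sigma> / 2 * (norm (u - x (Suc N)))\<^sup>2"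
          using \<open>\<sigma> > 0\<close> by simp
        also have "\<dots> \<le> V (Suc N)"
          unfolding V_def using xQ u by (intro bregman_ge_norm_sq[OF prox]) auto
        finally show "R - V (Suc N) \<le> R"
          by simp
      qed (simp add: w_def)
      finally show ?thesis
        unfolding T_def using S by (intro add_right_mono mult_left_mono) (auto simp: w_def)
    qed
    finally show ?thesis .
  qed
  then show ?thesis
    unfolding restricted_gap_def S_def T_def using \<open>Q \<noteq> {}\<close> by (intro cSUP_least) auto
qed

end
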